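(* For every integer $n\geqslant 3$, the sub-Eulerian polynomials of type $D$ satisfy the following difference-differential equations (primes denote $d/dt$): (i) $D_n^1(t)=[2(n-1)t-1]D_{n-1}^1(t)+2t(1-t)(D_{n-1}^1)'(t)+D_{n-1}^{0,1}(t)+tD_{n-1}^{\geqslant 2}(t)+D_{n-1}^{0,\geqslant 2}(t)$; (ii) $D_n^{0,1}(t)=[(2n-1)t-2]D_{n-1}^{0,1}(t)+2t(1-t)(D_{n-1}^{0,1})'(t)+tD_{n-1}^1(t)+t^2D_{n-1}^{\geqslant 2}(t)+tD_{n-1}^{0,\geqslant 2}(t)$; (iii) $D_n^{\geqslant 2}(t)=[2(n-2)t+1]D_{n-1}^{\geqslant 2}(t)+2t(1-t)(D_{n-1}^{\geqslant 2})'(t)+D_{n-1}^1(t)+t^{-1}D_{n-1}^{0,1}(t)+D_{n-1}^{0,\geqslant 2}(t)$; (iv) $D_n^{0,\geqslant 2}(t)=(2n-3)tD_{n-1}^{0,\geqslant 2}(t)+2t(1-t)(D_{n-1}^{0,\geqslant 2})'(t)+tD_{n-1}^1(t)+D_{n-1}^{0,1}(t)+tD_{n-1}^{\geqslant 2}(t)$.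
   Context: $B_n$ is the group of signed permutations $\pi=\pi_1\pi_2\cdots\pi_n$ of $\{1,\dots,n\}$, and $D_n\subset B_n$ is the subgroup (Coxeter group of type $D$) of those with an even number of negative entries. For $n\geqslant 2$, an index $i\in\{0,1,\dots,n-1\}$ is a ($D$-)descent of $\pi$ if $\pi_i>\pi_{i+1}$, where $\pi_0:=-\pi_2$. For $n\geqslant 2$ and an integer $k$, the sub-Eulerian numbers $D_{n,k}^1$, $D_{n,k}^{0,1}$, $D_{n,k}^{\geqslant 2}$, $D_{n,k}^{0,\geqslant 2}$ are the numbers of elements of $D_n$ with exactly $k$ descents such that, respectively: $1$ is a descent but $0$ is not; both $0$ and $1$ are descents; neither $0$ nor $1$ is a descent; $0$ is a descent but $1$ is not. For $*\in\{1;\ 0,1;\ \geqslant 2;\ 0,\geqslant 2\}$ the sub-Eulerian polynomials are $D_n^*(t)=\sum_{k\geqslant 0}D_{n,k}^*t^k$. *)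

theory Defs
  imports
    "HOL-Combinatorics.Permutations"
    "HOL-Computational_Algebra.Polynomial_Factorial"
begin

text \<open>
  A signed permutation is a permutation \<open>\<pi>\<close> of \<open>{-n, \<dots>, -1, 1, \<dots>, n}\<close> with
  \<open>\<pi> (-i) = - \<pi> i\<close>; its window \<open>\<pi>\<^sub>1 \<dots> \<pi>\<^sub>n\<close> is \<open>\<pi> 1, \<dots>, \<pi> n\<close>.
\<close>

definition signed_perms :: "nat \<Rightarrow> (int \<Rightarrow> int) set" where
  "signed_perms n =
     {\<pi>. \<pi> permutes ({- int n..int n} - {0}) \<and> (\<forall>i. \<pi> (- i) = - \<pi> i)}"

definition even_signed_perms :: "nat \<Rightarrow> (int \<Rightarrow> int) set" where
  "even_signed_perms n =
     {\<pi> \<in> signed_perms n. even (card {i \<in> {1..int n}. \<pi> i < 0})}"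

text \<open>
  The convention \<open>\<pi>\<^sub>0 = - \<pi>\<^sub>2\<close> concerns the word only: as a function, \<open>\<pi>\<close> fixes \<open>0\<close>.
\<close>

definition entry :: "(int \<Rightarrow> int) \<Rightarrow> nat \<Rightarrow> int" where
  "entry \<pi> i = (if i = 0 then - \<pi> 2 else \<pi> (int i))"

definition D_descents :: "nat \<Rightarrow> (int \<Rightarrow> int) \<Rightarrow> nat set" where
  "D_descents n \<pi> = {i \<in> {0..<n}. entry \<pi> i > entry \<pi> (Suc i)}"

text \<open>
  The set \<open>A \<subseteq> {0, 1}\<close> prescribes which of \<open>0\<close> and \<open>1\<close> are descents: the superscripts
  \<open>1\<close>; \<open>0,1\<close>; \<open>\<ge>2\<close>; \<open>0,\<ge>2\<close> correspond to \<open>A = {1}\<close>, \<open>{0, 1}\<close>, \<open>{}\<close>, \<open>{0}\<close>.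
\<close>

definition sub_Eulerian :: "nat set \<Rightarrow> nat \<Rightarrow> nat \<Rightarrow> nat" where
  "sub_Eulerian A n k =
     card {\<pi> \<in> even_signed_perms n.
             card (D_descents n \<pi>) = k \<and> D_descents n \<pi> \<inter> {0, 1} = A}"

text \<open>The sum stops at \<open>k = n\<close>, as there are only \<open>n\<close> possible descents.\<close>

definition sub_Eulerian_poly :: "nat set \<Rightarrow> nat \<Rightarrow> int poly" where
  "sub_Eulerian_poly A n = (\<Sum>k\<le>n. monom (int (sub_Eulerian A n k)) k)"

abbreviation D1 :: "nat \<Rightarrow> int poly" where
  "D1 \<equiv> sub_Eulerian_poly {1}"

abbreviation D01 :: "nat \<Rightarrow> int poly" where
  "D01 \<equiv> sub_Eulerian_poly {0, 1}"

abbreviation Dge2 :: "nat \<Rightarrow> int poly" where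
  "Dge2 \<equiv> sub_Eulerian_poly {}"

abbreviation D0ge2 :: "nat \<Rightarrow> int poly" where
  "D0ge2 \<equiv> sub_Eulerian_poly {0}"

text \<open>
  The indeterminate. It is not a unit of \<open>int poly\<close>, so an identity involving its inverse
  is to be read in the field of fractions, via \<^const>\<open>to_fract\<close>.
\<close>

abbreviation tvar :: "int poly" where
  "tvar \<equiv> [:0, 1:]"

end

theory Submission
  imports Defs
begin

text \<open>
  The parity condition that separates \<open>D\<^sub>n\<close> from \<open>B\<^sub>n\<close> is a nuisance for inductive
  counting: deleting the entry \<open>- n\<close> leaves \<open>D\<close>. It can be removed altogether. Changing the
  sign of the entry \<open>\<plusminus>1\<close> changes the parity, but alters no comparison between entries
  and no sign of a sum \<open>\<pi>\<^sub>1 + \<pi>\<^sub>2\<close>, since every other entry has absolute value at least 2.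
  So each sub-Eulerian polynomial is half of the analogous sum over all of \<open>B\<^sub>n\<close>
  (\<open>sum_even_words\<close>).

  On \<open>B\<^sub>n\<close> the recurrences come from inserting \<open>\<plusminus>n\<close> into the words of \<open>B\<^sub>n\<^sub>-\<^sub>1\<close>, each
  element of \<open>B\<^sub>n\<close> arising exactly once (\<open>bij_betw_insert_at\<close>). Let \<open>d\<close> be the number of
  descents of a word other than 0 and 1, and call its set of descents among 0 and 1 its type.
  Insertion after the second entry or later keeps the type. It raises \<open>d\<close> by one,
  except at a descent or at the very end with \<open>+ n\<close> (\<open>sum_des_insert_at\<close>); summing over
  all words, the factors \<open>d\<close> turn into the derivative. The four remaining insertions have a type
  that does not depend on the word: \<open>n\<close> in front gives type \<open>{1}\<close>, \<open>- n\<close> in front gives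
  \<open>{0}\<close>, while \<open>n\<close> and \<open>- n\<close> between the first two entries give \<open>{}\<close> and \<open>{0, 1}\<close>.
  They contribute the inhomogeneous terms of the four equations.

  Accordingly the generating functions below record \<open>d\<close> alone. The two descents 0 and 1
  only contribute a factor \<open>t\<^bsup>|A|\<^esup>\<close>, constant on the words of type \<open>A\<close>
  (\<open>sub_Eulerian_poly_eq\<close>), and in this normalisation the four equations are instances of
  one recurrence (\<open>tail_poly_Suc\<close>).
\<close>

section \<open>Signed permutations as words\<close>

definition signed_words :: "nat \<Rightarrow> int list set" where
  "signed_words n = {w. length w = n \<and> abs ` set w = {1..int n}}"

lemma length_signed_word: "w \<in> signed_words n \<Longrightarrow> length w = n"
  by (simp add: signed_words_def)

lemma abs_letter_signed_word:
  assumes "w \<in> signed_words n" "x \<in> set w"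
  shows "1 \<le> \<bar>x\<bar>" "\<bar>x\<bar> \<le> int n"
proof -
  have "abs ` set w = {1..int n}" using assms by (simp add: signed_words_def)
  then have "\<bar>x\<bar> \<in> {1..int n}" using assms(2) by blast
  then show "1 \<le> \<bar>x\<bar>" "\<bar>x\<bar> \<le> int n" by auto
qed

lemma distinct_abs_signed_word:
  assumes "w \<in> signed_words n"
  shows "distinct (map abs w)"
  using assms by (intro card_distinct) (simp add: signed_words_def)

lemma finite_signed_words: "finite (signed_words n)"
proof (rule finite_subset)
  show "signed_words n \<subseteq> {w. set w \<subseteq> {- int n..int n} \<and> length w = n}"
  proof
    fix w assume w: "w \<in> signed_words n"
    have "x \<in> {- int n..int n}" if "x \<in> set w" for x
      using abs_letter_signed_word(2)[OF w that] by auto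
    then show "w \<in> {w. set w \<subseteq> {- int n..int n} \<and> length w = n}"
      using w by (auto simp: signed_words_def)
  qed
  show "finite {w. set w \<subseteq> {- int n..int n} \<and> length w = n}"
    by (rule finite_lists_length_eq) simp
qed

definition window :: "nat \<Rightarrow> (int \<Rightarrow> int) \<Rightarrow> int list" where
  "window n \<pi> = map (\<lambda>i. \<pi> (int (Suc i))) [0..<n]"

lemma length_window [simp]: "length (window n \<pi>) = n"
  by (simp add: window_def)

lemma nth_window [simp]: "i < n \<Longrightarrow> window n \<pi> ! i = \<pi> (int (Suc i))"
  by (simp add: window_def)

lemma set_window: "set (window n \<pi>) = \<pi> ` {1..int n}"
proof -
  have "(\<lambda>i. int (Suc i)) ` {0..<n} = {1..int n}"
  proof
    show "{1..int n} \<subseteq> (\<lambda>i. int (Suc i)) ` {0..<n}"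
    proof
      fix x assume "x \<in> {1..int n}"
      then have "x = int (Suc (nat (x - 1)))" "nat (x - 1) \<in> {0..<n}" by auto
      then show "x \<in> (\<lambda>i. int (Suc i)) ` {0..<n}" by blast
    qed
  qed auto
  then have "\<pi> ` {1..int n} = (\<lambda>i. \<pi> (int (Suc i))) ` {0..<n}"
    by (metis image_image)
  then show ?thesis by (simp add: window_def)
qed

lemma window_in_signed_words:
  assumes "\<pi> \<in> signed_perms n"
  shows "window n \<pi> \<in> signed_words n"
proof -
  let ?S = "{- int n..int n} - {0}"
  have perm: "\<pi> permutes ?S" and odd: "\<And>i. \<pi> (- i) = - \<pi> i"
    using assms by (auto simp: signed_perms_def)
  have "abs ` \<pi> ` {1..int n} = {1..int n}"
  proof
    show "abs ` \<pi> ` {1..int n} \<subseteq> {1..int n}"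
    proof clarify
      fix i assume "i \<in> {1..int n}"
      then have "\<pi> i \<in> ?S" using permutes_in_image[OF perm, of i] by auto
      then show "\<bar>\<pi> i\<bar> \<in> {1..int n}" by auto
    qed
    show "{1..int n} \<subseteq> abs ` \<pi> ` {1..int n}"
    proof
      fix y assume y: "y \<in> {1..int n}"
      then have "y \<in> \<pi> ` ?S" using permutes_image[OF perm] by auto
      then obtain i where i: "i \<in> ?S" "y = \<pi> i" by blast
      show "y \<in> abs ` \<pi> ` {1..int n}"
      proof (cases "i > 0")
        case True
        then have "\<pi> i \<in> \<pi> ` {1..int n}" using i by auto
        moreover have "y = \<bar>\<pi> i\<bar>" using i y by simp
        ultimately show ?thesis by blast
      next
        case False
        then have "\<pi> (- i) \<in> \<pi> ` {1..int n}" using i by auto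
        moreover have "y = \<bar>\<pi> (- i)\<bar>" using i y odd[of i] by simp
        ultimately show ?thesis by blast
      qed
    qed
  qed
  then show ?thesis by (simp add: signed_words_def set_window)
qed

lemma inj_on_window: "inj_on (window n) (signed_perms n)"
proof (rule inj_onI)
  fix \<pi> \<sigma> assume \<pi>: "\<pi> \<in> signed_perms n" and \<sigma>: "\<sigma> \<in> signed_perms n"
    and eq: "window n \<pi> = window n \<sigma>"
  have pos: "\<pi> i = \<sigma> i" if "i > 0" for i
  proof (cases "i \<le> int n")
    case True
    then have "nat (i - 1) < n" using that by auto
    then show ?thesis using that arg_cong[OF eq, of "\<lambda>w. w ! nat (i - 1)"] by simp
  next
    case False
    then show ?thesis using \<pi> \<sigma> by (auto simp: signed_perms_def permutes_def)
  qed
  show "\<pi> = \<sigma>"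
  proof
    fix i
    have odd: "\<pi> (- i) = - \<pi> i" "\<sigma> (- i) = - \<sigma> i" "\<pi> 0 = 0" "\<sigma> 0 = 0"
      using \<pi> \<sigma> by (auto simp: signed_perms_def permutes_def)
    consider "i > 0" | "i = 0" | "- i > 0" by linarith
    then show "\<pi> i = \<sigma> i"
      by cases (use pos[of i] pos[of "- i"] odd in auto)
  qed
qed

lemma signed_word_is_window:
  assumes "w \<in> signed_words n"
  shows "\<exists>\<pi> \<in> signed_perms n. window n \<pi> = w"
proof -
  let ?S = "{- int n..int n} - {0}"
  have len: "length w = n" and abs_w: "abs ` set w = {1..int n}"
    using assms by (auto simp: signed_words_def)
  have dist: "distinct (map abs w)" by (rule distinct_abs_signed_word[OF assms])
  define \<pi> where "\<pi> i = (if i \<in> ?S then sgn i * w ! nat (\<bar>i\<bar> - 1) else i)" for i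
  have nth_mem_S: "\<bar>w ! k\<bar> \<in> {1..int n}" if "k < n" for k
    using that len abs_w nth_mem[of k w] by blast
  have odd: "\<pi> (- i) = - \<pi> i" for i
    by (auto simp: \<pi>_def)
  have val: "\<bar>\<pi> i\<bar> = \<bar>w ! nat (\<bar>i\<bar> - 1)\<bar>" "sgn (\<pi> i) = sgn i * sgn (w ! nat (\<bar>i\<bar> - 1))"
    "nat (\<bar>i\<bar> - 1) < n" if "i \<in> ?S" for i
    using that by (auto simp: \<pi>_def abs_mult sgn_mult abs_sgn_eq)
  have "\<pi> ` ?S \<subseteq> ?S"
  proof (rule image_subsetI)
    fix i assume "i \<in> ?S"
    then have "\<bar>\<pi> i\<bar> \<in> {1..int n}" using val[of i] nth_mem_S by auto
    then show "\<pi> i \<in> ?S" by auto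
  qed
  moreover have "inj_on \<pi> ?S"
  proof (rule inj_onI)
    fix i j assume ij: "i \<in> ?S" "j \<in> ?S" "\<pi> i = \<pi> j"
    then have "map abs w ! nat (\<bar>i\<bar> - 1) = map abs w ! nat (\<bar>j\<bar> - 1)"
      using val[of i] val[of j] len by simp
    then have "nat (\<bar>i\<bar> - 1) = nat (\<bar>j\<bar> - 1)"
      using dist ij val len by (subst (asm) nth_eq_iff_index_eq) auto
    then have "\<bar>i\<bar> = \<bar>j\<bar>" using ij by auto
    moreover have "sgn (w ! nat (\<bar>i\<bar> - 1)) \<noteq> 0"
      using nth_mem_S[OF val(3)[OF ij(1)]] by (auto simp: sgn_if)
    then have "sgn i = sgn j"
      using val(2)[OF ij(1)] val(2)[OF ij(2)] ij(3) \<open>\<bar>i\<bar> = \<bar>j\<bar>\<close> by auto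
    ultimately show "i = j" by (metis mult_sgn_abs)
  qed
  ultimately have "bij_betw \<pi> ?S ?S"
    by (intro bij_betw_imageI endo_inj_surj) auto
  then have "\<pi> permutes ?S"
    by (rule bij_imp_permutes) (auto simp: \<pi>_def)
  then have "\<pi> \<in> signed_perms n" using odd by (simp add: signed_perms_def)
  moreover have "window n \<pi> = w"
    by (rule nth_equalityI) (auto simp: len \<pi>_def)
  ultimately show ?thesis by blast
qed

lemma bij_betw_window: "bij_betw (window n) (signed_perms n) (signed_words n)"
proof (rule bij_betw_imageI[OF inj_on_window])
  show "window n ` signed_perms n = signed_words n"
    using window_in_signed_words signed_word_is_window by blast
qed

section \<open>Descents of words\<close>

fun des :: "int list \<Rightarrow> nat" where
  "des (a # b # w) = of_bool (b < a) + des (b # w)"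
| "des _ = 0"

lemma des_eq_card: "des w = card {i. Suc i < length w \<and> w ! Suc i < w ! i}"
proof (induction w rule: des.induct)
  case (1 a b w)
  let ?I = "{i. Suc i < length (b # w) \<and> (b # w) ! Suc i < (b # w) ! i}"
  have "{i. Suc i < length (a # b # w) \<and> (a # b # w) ! Suc i < (a # b # w) ! i}
      = (if b < a then {0} else {}) \<union> Suc ` ?I" (is "?J = _")
  proof (rule set_eqI)
    fix i show "i \<in> ?J \<longleftrightarrow> i \<in> (if b < a then {0} else {}) \<union> Suc ` ?I"
      by (cases i) (auto simp: image_iff)
  qed
  moreover have "finite ?I" by (rule finite_subset[of _ "{..<length (b # w)}"]) auto
  ultimately show ?case using 1 by (simp add: card_insert_if card_image)
qed auto

text \<open>
  The descents among 0 and 1. With \<open>\<pi>\<^sub>0 = - \<pi>\<^sub>2\<close>, the condition \<open>\<pi>\<^sub>0 > \<pi>\<^sub>1\<close> reads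
  \<open>\<pi>\<^sub>1 + \<pi>\<^sub>2 < 0\<close>.
\<close>
fun head_descents :: "int list \<Rightarrow> nat set" where
  "head_descents (a # b # w) = (if a + b < 0 then {0} else {}) \<union> (if b < a then {1} else {})"
| "head_descents _ = {}"

text \<open>
  Dropping the first letter of the window removes exactly the comparison at 1, and the
  comparison at 0 is none between adjacent letters, so the descents from 2 on are the descents
  of the tail.
\<close>
lemma D_descents_window:
  assumes "n \<ge> 2"
  shows "D_descents n \<pi> \<inter> {0, 1} = head_descents (window n \<pi>)" (is ?head)
    and "card (D_descents n \<pi>)
      = card (head_descents (window n \<pi>)) + des (tl (window n \<pi>))" (is ?card)
proof -
  obtain m where n: "n = Suc (Suc m)" using assms by (metis add_2_eq_Suc le_Suc_ex)
  have "window n \<pi> = \<pi> 1 # \<pi> 2 # drop 2 (window n \<pi>)"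
    by (rule nth_equalityI) (auto simp: n nth_Cons split: nat.split)
  then obtain l where l: "window n \<pi> = \<pi> 1 # \<pi> 2 # l" by blast
  show head: ?head
    using assms unfolding l by (auto simp: D_descents_def entry_def)
  have tail: "des (tl (window n \<pi>)) = card (D_descents n \<pi> - {0, 1})"
  proof -
    have nth: "tl (window n \<pi>) ! i = \<pi> (int (i + 2))" if "Suc i < n" for i
      using that by (simp add: nth_tl)
    have "D_descents n \<pi> - {0, 1}
        = (\<lambda>i. i + 2) ` {i. Suc i < length (tl (window n \<pi>))
                          \<and> tl (window n \<pi>) ! Suc i < tl (window n \<pi>) ! i}" (is "?L = _ ` ?R")
    proof (intro set_eqI iffI)
      fix k assume k: "k \<in> ?L"
      then have "k \<ge> 2" by (cases k) auto
      then obtain i where "k = i + 2" by (metis add.commute le_Suc_ex)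
      moreover from this have "i \<in> ?R"
        using k by (auto simp: D_descents_def entry_def nth)
      ultimately show "k \<in> (\<lambda>i. i + 2) ` ?R" by blast
    next
      fix k assume "k \<in> (\<lambda>i. i + 2) ` ?R"
      then show "k \<in> ?L" by (auto simp: D_descents_def entry_def nth)
    qed
    then show ?thesis by (simp add: des_eq_card card_image inj_on_def)
  qed
  have fin: "finite (D_descents n \<pi>)" by (simp add: D_descents_def)
  then have "card (D_descents n \<pi>)
      = card (D_descents n \<pi> \<inter> {0, 1}) + card (D_descents n \<pi> - {0, 1})"
    by (subst card_Un_disjoint[symmetric]) (auto intro: arg_cong[of _ _ card])
  then show ?card using head tail by simp
qed

section \<open>Forgetting the parity condition\<close>

definition flip_one :: "int \<Rightarrow> int" where
  "flip_one x = (if \<bar>x\<bar> = 1 then - x else x)"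

lemma flip_one_simps [simp]: "flip_one (flip_one x) = x" "\<bar>flip_one x\<bar> = \<bar>x\<bar>"
  by (auto simp: flip_one_def)

text \<open>
  Distinct absolute values exclude the pair \<open>1, - 1\<close>, the only one of distinct non-zero integers
  that the sign change could affect.
\<close>
lemma flip_one_comparisons:
  assumes "\<bar>x\<bar> \<noteq> \<bar>y\<bar>" "x \<noteq> 0" "y \<noteq> 0"
  shows "flip_one x < flip_one y \<longleftrightarrow> x < y" "flip_one x + flip_one y < 0 \<longleftrightarrow> x + y < 0"
  using assms by (auto simp: flip_one_def)

lemma des_map_flip_one:
  assumes "distinct (map abs w)" "0 \<notin> set w"
  shows "des (map flip_one w) = des w"
  using assms by (induction w rule: des.induct) (auto simp: flip_one_comparisons)

lemma head_descents_map_flip_one: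
  assumes "distinct (map abs w)" "0 \<notin> set w"
  shows "head_descents (map flip_one w) = head_descents w"
  using assms by (cases w rule: head_descents.cases) (auto simp: flip_one_comparisons)

lemma zero_notin_signed_word: "w \<in> signed_words n \<Longrightarrow> 0 \<notin> set w"
  using abs_letter_signed_word(1)[of w n 0] by auto

lemma map_flip_one_in_signed_words:
  "w \<in> signed_words n \<Longrightarrow> map flip_one w \<in> signed_words n"
  by (simp add: signed_words_def image_image)

definition even_word :: "int list \<Rightarrow> bool" where
  "even_word w \<longleftrightarrow> even (length (filter (\<lambda>x. x < 0) w))"

lemma even_word_map_flip_one:
  assumes "w \<in> signed_words n" "n \<ge> 1"
  shows "even_word (map flip_one w) \<longleftrightarrow> \<not> even_word w"
proof -
  have "1 \<in> abs ` set w" using assms by (auto simp: signed_words_def)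
  then obtain x where x: "x \<in> set w" "\<bar>x\<bar> = 1" by auto
  then obtain u v where w: "w = u @ x # v" by (meson split_list)
  have "\<forall>y \<in> set u \<union> set v. flip_one y = y"
    using distinct_abs_signed_word[OF assms(1)] x by (auto simp: w flip_one_def)
  then have "map flip_one u = u" "map flip_one v = v" by (simp_all add: map_idI)
  then show ?thesis using x by (auto simp: w even_word_def flip_one_def)
qed

lemma even_signed_perms_eq:
  "even_signed_perms n = {\<pi> \<in> signed_perms n. even_word (window n \<pi>)}"
proof -
  have "card {i \<in> {1..int n}. \<pi> i < 0} = length (filter (\<lambda>x. x < 0) (window n \<pi>))" for \<pi>
  proof -
    have "{i \<in> {1..int n}. \<pi> i < 0} = (\<lambda>i. int (Suc i)) ` {i. i < n \<and> \<pi> (int (Suc i)) < 0}"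
    proof (intro set_eqI iffI)
      fix k assume "k \<in> {i \<in> {1..int n}. \<pi> i < 0}"
      then have "k = int (Suc (nat (k - 1)))" "nat (k - 1) \<in> {i. i < n \<and> \<pi> (int (Suc i)) < 0}"
        by auto
      then show "k \<in> (\<lambda>i. int (Suc i)) ` {i. i < n \<and> \<pi> (int (Suc i)) < 0}" by blast
    qed auto
    moreover have "{i. i < n \<and> \<pi> (int (Suc i)) < 0} = {i. i < n \<and> window n \<pi> ! i < 0}"
      by auto
    ultimately show ?thesis
      by (simp add: length_filter_conv_card card_image inj_on_def)
  qed
  then show ?thesis by (simp add: even_signed_perms_def even_word_def)
qed

text \<open>
  The exponent omits the descents at 0 and 1, whose number is \<open>card A\<close>, and the sum runs over
  both parities.
\<close>
definition tail_poly :: "nat set \<Rightarrow> nat \<Rightarrow> int poly" where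
  "tail_poly A n
    = (\<Sum>w \<in> signed_words n. if head_descents w = A then tvar ^ des (tl w) else 0)"

text \<open>
  The sign change of the letter \<open>\<plusminus>1\<close> matches the even words with the odd ones.
\<close>
lemma sum_even_words:
  fixes f :: "int list \<Rightarrow> 'a :: comm_semiring_1"
  assumes "n \<ge> 1" and inv: "\<And>w. w \<in> signed_words n \<Longrightarrow> f (map flip_one w) = f w"
  shows "2 * (\<Sum>w \<in> {w \<in> signed_words n. even_word w}. f w) = (\<Sum>w \<in> signed_words n. f w)"
proof -
  let ?E = "{w \<in> signed_words n. even_word w}" and ?O = "{w \<in> signed_words n. \<not> even_word w}"
  have "sum f ?E = sum f ?O"
    by (rule sum.reindex_bij_witness[of _ "map flip_one" "map flip_one"])
       (use assms even_word_map_flip_one map_flip_one_in_signed_words in \<open>auto simp: o_def\<close>)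
  moreover have "sum f (signed_words n) = sum f ?E + sum f ?O"
    by (subst sum.union_disjoint[symmetric])
       (auto simp: finite_signed_words intro: sum.cong)
  ultimately show ?thesis by (simp add: mult_2)
qed

lemma sum_monom_card:
  assumes "finite S" "\<And>x. x \<in> S \<Longrightarrow> f x \<le> (n::nat)"
  shows "(\<Sum>k\<le>n. monom (int (card {x \<in> S. f x = k})) k) = (\<Sum>x\<in>S. tvar ^ f x)"
proof -
  have "(\<Sum>x\<in>S. tvar ^ f x) = (\<Sum>k\<le>n. \<Sum>x\<in>{x \<in> S. f x = k}. tvar ^ f x)"
    using assms by (intro sum.group[symmetric]) auto
  also have "\<dots> = (\<Sum>k\<le>n. monom (int (card {x \<in> S. f x = k})) k)"
  proof (rule sum.cong)
    fix k
    have "(\<Sum>x\<in>{x \<in> S. f x = k}. tvar ^ f x) = (\<Sum>x\<in>{x \<in> S. f x = k}. tvar ^ k)"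
      by (rule sum.cong) auto
    then show "(\<Sum>x\<in>{x \<in> S. f x = k}. tvar ^ f x) = monom (int (card {x \<in> S. f x = k})) k"
      by (simp add: monom_altdef of_nat_poly)
  qed simp
  finally show ?thesis by simp
qed

lemma sub_Eulerian_poly_eq:
  assumes "n \<ge> 2"
  shows "2 * sub_Eulerian_poly A n = tvar ^ card A * tail_poly A n"
proof -
  let ?f = "\<lambda>w. if head_descents w = A then tvar ^ des (tl w) else (0 :: int poly)"
  have fin: "finite (signed_perms n)"
    using bij_betw_finite[OF bij_betw_window] finite_signed_words by blast
  let ?S = "{\<pi> \<in> even_signed_perms n. D_descents n \<pi> \<inter> {0, 1} = A}"
  have finS: "finite ?S" using fin by (auto simp: even_signed_perms_def)
  have le: "card (D_descents n \<pi>) \<le> n" for \<pi>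
  proof -
    have "D_descents n \<pi> \<subseteq> {0..<n}" by (auto simp: D_descents_def)
    then show ?thesis using card_mono[of "{0..<n}"] by fastforce
  qed
  have "sub_Eulerian_poly A n
      = (\<Sum>k\<le>n. monom (int (card {\<pi> \<in> ?S. card (D_descents n \<pi>) = k})) k)"
    unfolding sub_Eulerian_poly_def sub_Eulerian_def
    by (intro sum.cong arg_cong2[where f=monom] arg_cong[where f=int] arg_cong[where f=card]) auto
  also have "\<dots> = (\<Sum>\<pi>\<in>?S. tvar ^ card (D_descents n \<pi>))"
    by (rule sum_monom_card[OF finS le])
  also have "\<dots> = (\<Sum>\<pi>\<in>even_signed_perms n. tvar ^ card A * ?f (window n \<pi>))"
    using fin assms unfolding D_descents_window(1)[OF assms] D_descents_window(2)[OF assms]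
    by (intro sum.mono_neutral_cong_left) (auto simp: even_signed_perms_def power_add)
  also have "\<dots> = tvar ^ card A * (\<Sum>\<pi>\<in>even_signed_perms n. ?f (window n \<pi>))"
    by (rule sum_distrib_left[symmetric])
  also have "(\<Sum>\<pi>\<in>even_signed_perms n. ?f (window n \<pi>))
      = (\<Sum>w\<in>{w \<in> signed_words n. even_word w}. ?f w)"
  proof (rule sum.reindex_bij_betw)
    have "window n ` even_signed_perms n = {w \<in> signed_words n. even_word w}"
      using bij_betw_window[of n] by (auto simp: even_signed_perms_eq bij_betw_def)
    then show "bij_betw (window n) (even_signed_perms n) {w \<in> signed_words n. even_word w}"
      using inj_on_window[of n] by (auto simp: bij_betw_def even_signed_perms_eq inj_on_def)
  qed
  finally have "2 * sub_Eulerian_poly A n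
      = tvar ^ card A * (2 * (\<Sum>w\<in>{w \<in> signed_words n. even_word w}. ?f w))"
    by (simp only: mult.left_commute)
  also have "2 * (\<Sum>w\<in>{w \<in> signed_words n. even_word w}. ?f w) = tail_poly A n"
    unfolding tail_poly_def
  proof (rule sum_even_words)
    fix w assume w: "w \<in> signed_words n"
    have "distinct (map abs w)" "0 \<notin> set w"
      using w distinct_abs_signed_word zero_notin_signed_word by auto
    moreover from this have "distinct (map abs (tl w))" "0 \<notin> set (tl w)"
      by (cases w; simp)+
    ultimately show "?f (map flip_one w) = ?f w"
      by (simp add: map_tl[symmetric] des_map_flip_one head_descents_map_flip_one)
  qed (use assms in simp)
  finally show ?thesis .
qed

section \<open>Inserting the largest letter\<close>

definition insert_at :: "nat \<Rightarrow> 'a \<Rightarrow> 'a list \<Rightarrow> 'a list" where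
  "insert_at j x w = take j w @ x # drop j w"

lemma insert_at_simps [simp]:
  "insert_at 0 x w = x # w" "insert_at (Suc j) x (a # w) = a # insert_at j x w"
  by (simp_all add: insert_at_def)

text \<open>
  The letter of absolute value \<open>m + 1\<close> occurs once in a signed word of length \<open>m + 1\<close>, so
  its place, its sign and the rest of the word can be read off.
\<close>
lemma bij_betw_insert_at:
  "bij_betw (\<lambda>(w, j, x). insert_at j x w)
     (signed_words m \<times> {..m} \<times> {int (Suc m), - int (Suc m)}) (signed_words (Suc m))"
  (is "bij_betw ?ins ?A ?B")
proof -
  have notin: "x \<notin> set w" if "w \<in> signed_words m" "\<bar>x\<bar> = int (Suc m)" for w x
    using abs_letter_signed_word(2)[OF that(1)] that(2) by force
  have interval: "{1..int (Suc m)} = insert (int (Suc m)) {1..int m}" by auto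
  have "inj_on ?ins ?A"
  proof (rule inj_onI)
    fix p q assume pq: "p \<in> ?A" "q \<in> ?A" "?ins p = ?ins q"
    obtain w j x v k y where p: "p = (w, j, x)" and q: "q = (v, k, y)" by (metis prod_cases3)
    have w: "w \<in> signed_words m" "j \<le> m" "x \<in> {int (Suc m), - int (Suc m)}"
      and v: "v \<in> signed_words m" "k \<le> m" "y \<in> {int (Suc m), - int (Suc m)}"
      and eq: "insert_at j x w = insert_at k y v"
      using pq by (auto simp: p q)
    have xy: "\<bar>x\<bar> = int (Suc m)" "\<bar>y\<bar> = int (Suc m)" using w v by auto
    have notin': "x \<notin> set w" "y \<notin> set w" "x \<notin> set v" "y \<notin> set v"
      using notin w(1) v(1) xy by auto
    have "x \<in> set (insert_at k y v)" using eq by (metis in_set_conv_decomp insert_at_def)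
    then have "x = y"
      using notin' by (auto simp: insert_at_def dest: in_set_takeD in_set_dropD)
    have "x \<notin> set (take j w)" "x \<notin> set (drop j w)"
      using notin' by (auto dest: in_set_takeD in_set_dropD)
    then have "take j w = take k v \<and> drop j w = drop k v"
      using eq \<open>x = y\<close> by (simp add: insert_at_def append_Cons_eq_iff)
    moreover from this have "j = k"
      using w(1,2) v(1,2) by (metis length_signed_word length_take min.absorb2)
    ultimately show "p = q"
      using \<open>x = y\<close> unfolding p q by (metis append_take_drop_id)
  qed
  moreover have "?ins ` ?A = ?B"
  proof (intro equalityI subsetI)
    fix u assume "u \<in> ?ins ` ?A"
    then obtain w j x where w: "w \<in> signed_words m" "j \<le> m" "\<bar>x\<bar> = int (Suc m)"
      and u: "u = insert_at j x w" by force
    have "set u = insert x (set (take j w) \<union> set (drop j w))"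
      by (auto simp: u insert_at_def)
    then have "set u = insert x (set w)"
      by (simp only: set_append[symmetric] append_take_drop_id)
    moreover have "length u = Suc m" using w by (simp add: u insert_at_def signed_words_def)
    moreover have "abs ` set w = {1..int m}" using w(1) by (simp add: signed_words_def)
    ultimately show "u \<in> ?B"
      unfolding signed_words_def interval using w(3) by simp
  next
    fix u assume u: "u \<in> ?B"
    then have "int (Suc m) \<in> abs ` set u" by (simp add: signed_words_def)
    then obtain x where x: "x \<in> set u" "\<bar>x\<bar> = int (Suc m)" by auto
    then obtain xs ys where split: "u = xs @ x # ys" by (meson split_list)
    have "abs ` set u = insert \<bar>x\<bar> (abs ` set (xs @ ys))" by (auto simp: split)
    moreover have "\<bar>x\<bar> \<notin> abs ` set (xs @ ys)"
      using distinct_abs_signed_word[OF u] by (auto simp: split)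
    moreover have "abs ` set u = insert \<bar>x\<bar> {1..int m}"
      using u x(2) interval by (simp add: signed_words_def)
    moreover have "\<bar>x\<bar> \<notin> {1..int m}" using x(2) by simp
    ultimately have "abs ` set (xs @ ys) = {1..int m}" by (simp add: insert_ident)
    moreover have "length (xs @ ys) = m" using u by (simp add: split signed_words_def)
    ultimately have "xs @ ys \<in> signed_words m" "length xs \<le> m"
      by (auto simp: signed_words_def)
    moreover have "u = insert_at (length xs) x (xs @ ys)" by (simp add: split insert_at_def)
    moreover have "x \<in> {int (Suc m), - int (Suc m)}" using x(2) by auto
    ultimately show "u \<in> ?ins ` ?A" by (intro image_eqI[of _ _ "(xs @ ys, length xs, x)"]) auto
  qed
  ultimately show ?thesis by (simp add: bij_betw_def)
qed

lemma sum_signed_words_Suc: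
  fixes f :: "int list \<Rightarrow> 'a :: comm_monoid_add"
  shows "(\<Sum>u\<in>signed_words (Suc m). f u)
    = (\<Sum>w\<in>signed_words m. \<Sum>j\<le>m. f (insert_at j (int (Suc m)) w) + f (insert_at j (- int (Suc m)) w))"
proof -
  have "(\<Sum>u\<in>signed_words (Suc m). f u)
     = (\<Sum>(w, j, x)\<in>signed_words m \<times> {..m} \<times> {int (Suc m), - int (Suc m)}. f (insert_at j x w))"
    by (subst sum.reindex_bij_betw[OF bij_betw_insert_at, symmetric]) (simp add: case_prod_unfold)
  also have "\<dots> = (\<Sum>w\<in>signed_words m. \<Sum>j\<le>m. \<Sum>x\<in>{int (Suc m), - int (Suc m)}. f (insert_at j x w))"
    by (simp only: sum.cartesian_product)
  finally show ?thesis by simp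
qed

text \<open>
  Next to smaller letters, \<open>N\<close> creates an ascent before and a descent after it, and \<open>- N\<close> the
  opposite. Between two letters, either insertion thus replaces their comparison by exactly one
  descent, so the number of descents stays \<open>d\<close> at each of the \<open>d\<close> descents and becomes
  \<open>d + 1\<close> at each of the \<open>length l - d\<close> ascents. At the right end, \<open>N\<close> adds an ascent and
  \<open>- N\<close> a descent. The list \<open>b # l\<close> is a tail, and insertion in
  front of \<open>b\<close> would change the type of the whole word.
\<close>
lemma sum_des_insert_at:
  fixes t :: "'a :: comm_ring_1"
  assumes "\<forall>y \<in> set (b # l). \<bar>y\<bar> < N"
  defines "d \<equiv> des (b # l)"
  shows "(\<Sum>j\<le>length l. t ^ des (b # insert_at j N l) + t ^ des (b # insert_at j (- N) l))
    = ((2 * of_nat d + 1) + (2 * (of_nat (length l) - of_nat d) + 1) * t) * t ^ d"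
  using assms(1) unfolding d_def
proof (induction l arbitrary: b)
  case Nil
  then show ?case by auto
next
  case (Cons c l)
  let ?d = "des (c # l)" and ?e = "of_bool (c < b) :: nat"
  let ?S = "\<lambda>b l. \<Sum>j\<le>length l. t ^ des (b # insert_at j N l) + t ^ des (b # insert_at j (- N) l)"
  have IH: "?S c l = ((2 * of_nat ?d + 1) + (2 * (of_nat (length l) - of_nat ?d) + 1) * t) * t ^ ?d"
    using Cons.prems by (intro Cons.IH) auto
  have "?S b (c # l) = 2 * t ^ (?d + 1) + t ^ ?e * ?S c l"
    using Cons.prems
    by (simp add: sum.atMost_Suc_shift power_add sum_distrib_left distrib_left del: sum.atMost_Suc) auto
  then show ?case unfolding IH
    by (auto simp: algebra_simps)
qed

text \<open>
  The contribution of all insertions into one word \<open>w = a b \<dots>\<close> to the words of type \<open>A\<close>.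
  Placing \<open>\<plusminus>N\<close> first makes \<open>w\<close> itself the tail. With \<open>\<plusminus>N\<close> second the tail is
  \<open>\<plusminus>N b \<dots>\<close>, in which only \<open>N\<close> creates a descent. These insertions have a fixed type; the
  others keep the type of \<open>w\<close> and insert into its tail.
\<close>
lemma sum_insert_at:
  fixes t :: "'a :: comm_ring_1" and w :: "int list"
  assumes "length w \<ge> 2" "\<forall>y \<in> set w. \<bar>y\<bar> < N"
  defines "f \<equiv> \<lambda>A w. if head_descents w = A then t ^ des (tl w) else 0"
    and "d \<equiv> des (tl w)"
  shows "(\<Sum>j\<le>length w. f A (insert_at j N w) + f A (insert_at j (- N) w))
    = (if A = {1} \<or> A = {0} then t ^ des w else 0)
    + (if A = {} then t * t ^ d else 0) + (if A = {0, 1} then t ^ d else 0)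
    + (if head_descents w = A
       then ((2 * of_nat d + 1) + (2 * (of_nat (length w) - 2 - of_nat d) + 1) * t) * t ^ d else 0)"
proof -
  obtain a b l where w: "w = a # b # l"
    using assms(1) by (metis One_nat_def Suc_1 Suc_le_length_iff)
  let ?S = "\<Sum>j\<le>length l. f A (a # b # insert_at j N l) + f A (a # b # insert_at j (- N) l)"
  have H: "head_descents (a # b # u) = head_descents w" for u
    by (simp add: w)
  have S: "?S = (if head_descents w = A
       then ((2 * of_nat d + 1) + (2 * (of_nat (length w) - 2 - of_nat d) + 1) * t) * t ^ d else 0)"
  proof (cases "head_descents w = A")
    case True
    have "?S = (\<Sum>j\<le>length l. t ^ des (b # insert_at j N l) + t ^ des (b # insert_at j (- N) l))"
      unfolding f_def H True by simp
    also have "\<dots> = ((2 * of_nat d + 1) + (2 * (of_nat (length l) - of_nat d) + 1) * t) * t ^ d"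
      using sum_des_insert_at[of b l N t] assms(2) unfolding d_def w by simp
    finally show ?thesis using True by (simp add: w)
  next
    case False
    then show ?thesis unfolding f_def H by simp
  qed
  have bounds: "\<bar>a\<bar> < N" "\<bar>b\<bar> < N" using assms(2) by (auto simp: w)
  have heads: "head_descents (N # w) = {1}" "head_descents (- N # w) = {0}"
    "head_descents (a # N # b # l) = {}" "head_descents (a # - N # b # l) = {0, 1}"
    using bounds by (auto simp: w)
  have dess: "des (tl (N # w)) = des w" "des (tl (- N # w)) = des w"
    "des (tl (a # N # b # l)) = Suc d" "des (tl (a # - N # b # l)) = d"
    using bounds by (auto simp: w d_def)
  have "(\<Sum>j\<le>length w. f A (insert_at j N w) + f A (insert_at j (- N) w))
      = (f A (N # w) + f A (- N # w)) + (f A (a # N # b # l) + f A (a # - N # b # l)) + ?S"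
    by (simp add: w sum.atMost_Suc_shift del: sum.atMost_Suc)
  moreover have "f A (N # w) + f A (- N # w) = (if A = {1} \<or> A = {0} then t ^ des w else 0)"
    unfolding f_def heads dess by auto
  moreover have "f A (a # N # b # l) + f A (a # - N # b # l)
      = (if A = {} then t * t ^ d else 0) + (if A = {0, 1} then t ^ d else 0)"
    unfolding f_def heads dess by auto
  ultimately show ?thesis using S by (simp only: add.assoc)
qed

section \<open>The recurrences\<close>

text \<open>
  The Euler operator \<open>t d/dt\<close>, by which a weight linear in the number of descents becomes a
  derivative of the generating function.
\<close>
lemma times_pderiv_power:
  fixes p :: "'a :: idom poly"
  assumes "pderiv p = 1"
  shows "p * pderiv (p ^ d) = of_nat d * p ^ d"
proof (cases d)
  case (Suc k)
  show ?thesis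
    unfolding Suc pderiv_power_Suc assms by (simp add: of_nat_poly del: of_nat_Suc)
qed simp

lemma sum_by_head_descents:
  assumes "\<And>w. w \<in> signed_words m \<Longrightarrow> f w = g (head_descents w) * tvar ^ des (tl w)"
  shows "(\<Sum>w\<in>signed_words m. f w)
    = g {} * tail_poly {} m + g {0} * tail_poly {0} m
      + g {1} * tail_poly {1} m + g {0, 1} * tail_poly {0, 1} m"
proof -
  have "head_descents w \<in> {{}, {0}, {1}, {0, 1}}" for w
    by (cases w rule: head_descents.cases) auto
  then have "f w = (\<Sum>A\<in>{{}, {0}, {1}, {0, 1}}.
      g A * (if head_descents w = A then tvar ^ des (tl w) else 0))" if "w \<in> signed_words m" for w
    using assms[OF that] by (simp add: if_distrib[of "(*) _"] cong: if_cong)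
  then have "(\<Sum>w\<in>signed_words m. f w) = (\<Sum>w\<in>signed_words m. \<Sum>A\<in>{{}, {0}, {1}, {0, 1}}.
      g A * (if head_descents w = A then tvar ^ des (tl w) else 0))"
    by (rule sum.cong[OF refl])
  also have "\<dots> = (\<Sum>A\<in>{{}, {0}, {1}, {0, 1}}. g A * tail_poly A m)"
    by (subst sum.swap) (simp only: tail_poly_def sum_distrib_left)
  finally show ?thesis by (simp add: add.assoc)
qed

text \<open>
  The four equations at once. Insertion in front yields a tail with all descents of the old word
  but 0, which accounts for the extra factor \<open>t\<close> on the types containing 1.
\<close>
lemma tail_poly_Suc:
  fixes A :: "nat set"
  assumes "m \<ge> 2"
  defines "P \<equiv> tail_poly {} m" and "P0 \<equiv> tail_poly {0} m"
    and "P1 \<equiv> tail_poly {1} m" and "P01 \<equiv> tail_poly {0, 1} m"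
  shows "tail_poly A (Suc m)
    = (if A = {1} \<or> A = {0} then P + P0 + tvar * (P1 + P01) else 0)
    + (if A = {} then tvar * (P + P0 + P1 + P01) else 0)
    + (if A = {0, 1} then P + P0 + P1 + P01 else 0)
    + (1 + (2 * of_nat m - 3) * tvar) * tail_poly A m
    + 2 * tvar * (1 - tvar) * pderiv (tail_poly A m)"
proof -
  define t where "t = tvar"
  have "pderiv t = 1" by (simp add: t_def pderiv_pCons)
  note t_folds = sum_by_head_descents[folded t_def] tail_poly_def[folded t_def]
    times_pderiv_power[OF this]
  let ?W = "signed_words m"
  let ?f = "\<lambda>w. if head_descents w = A then t ^ des (tl w) else 0"
  let ?g = "\<lambda>w. if head_descents w = A
     then ((2 * of_nat (des (tl w)) + 1) + (2 * (of_nat (length w) - 2 - of_nat (des (tl w))) + 1) * t)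
       * t ^ des (tl w) else 0"
  have all: "(\<Sum>w\<in>?W. t ^ des (tl w)) = P + P0 + P1 + P01"
    using t_folds(1)[of m "\<lambda>w. t ^ des (tl w)" "\<lambda>_. 1"]
    by (simp add: P_def P0_def P1_def P01_def)
  have "t ^ des w = (if 1 \<in> head_descents w then t else 1) * t ^ des (tl w)" for w
    by (cases w rule: head_descents.cases) auto
  from t_folds(1)[of m "\<lambda>w. t ^ des w" "\<lambda>A. if 1 \<in> A then t else 1", OF this]
  have des: "(\<Sum>w\<in>?W. t ^ des w) = P + P0 + t * (P1 + P01)"
    by (simp add: P_def P0_def P1_def P01_def algebra_simps)
  \<comment> \<open>The part of the factor that is linear in \<open>d\<close> is \<open>2 d (1 - t)\<close>, which becomes the derivative.\<close>
  have "?g w = (1 + (2 * of_nat m - 3) * t) * ?f w + 2 * (1 - t) * (t * pderiv (?f w))"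
    if "w \<in> ?W" for w
  proof (cases "head_descents w = A")
    case True
    then show ?thesis
      unfolding length_signed_word[OF that] True
      by (simp only: if_True refl t_folds(3)) algebra
  qed simp
  then have g: "(\<Sum>w\<in>?W. ?g w) = (1 + (2 * of_nat m - 3) * t) * tail_poly A m
    + 2 * t * (1 - t) * pderiv (tail_poly A m)"
    by (simp add: t_folds(2) higher_pderiv_sum[of 1, simplified] sum.distrib sum_distrib_left mult_ac)
  have "tail_poly A (Suc m) = (\<Sum>w\<in>?W. \<Sum>j\<le>length w.
      ?f (insert_at j (int (Suc m)) w) + ?f (insert_at j (- int (Suc m)) w))"
    unfolding t_folds(2) sum_signed_words_Suc by (simp add: length_signed_word)
  also have "\<dots> = (\<Sum>w\<in>?W. (if A = {1} \<or> A = {0} then t ^ des w else 0)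
    + (if A = {} then t * t ^ des (tl w) else 0)
    + (if A = {0, 1} then t ^ des (tl w) else 0) + ?g w)"
  proof (rule sum.cong)
    fix w assume w: "w \<in> ?W"
    have "\<bar>y\<bar> < int (Suc m)" if "y \<in> set w" for y
      using abs_letter_signed_word(2)[OF w that] by simp
    then show "(\<Sum>j\<le>length w. ?f (insert_at j (int (Suc m)) w) + ?f (insert_at j (- int (Suc m)) w))
      = (if A = {1} \<or> A = {0} then t ^ des w else 0)
        + (if A = {} then t * t ^ des (tl w) else 0)
        + (if A = {0, 1} then t ^ des (tl w) else 0) + ?g w"
      using assms(1) length_signed_word[OF w] by (intro sum_insert_at) auto
  qed simp
  also have "\<dots> = (if A = {1} \<or> A = {0} then \<Sum>w\<in>?W. t ^ des w else 0)
    + (if A = {} then t * (\<Sum>w\<in>?W. t ^ des (tl w)) else 0)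
    + (if A = {0, 1} then \<Sum>w\<in>?W. t ^ des (tl w) else 0) + (\<Sum>w\<in>?W. ?g w)"
    unfolding sum.distrib sum_distrib_left by (intro arg_cong2[where f="(+)"]) auto
  finally show ?thesis unfolding all des g unfolding t_def by (simp only: add.assoc)
qed

theorem proposition3p3:
  fixes n :: nat
  assumes "n \<ge> 3"
  shows
    "(D1 n = (2 * (of_nat n - 1) * tvar - 1) * D1 (n - 1)
        + 2 * tvar * (1 - tvar) * pderiv (D1 (n - 1))
        + D01 (n - 1) + tvar * Dge2 (n - 1) + D0ge2 (n - 1))
   \<and> (D01 n = ((2 * of_nat n - 1) * tvar - 2) * D01 (n - 1)
        + 2 * tvar * (1 - tvar) * pderiv (D01 (n - 1))
        + tvar * D1 (n - 1) + tvar ^ 2 * Dge2 (n - 1) + tvar * D0ge2 (n - 1))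
   \<and> (to_fract (Dge2 n) = to_fract ((2 * (of_nat n - 2) * tvar + 1) * Dge2 (n - 1))
        + to_fract (2 * tvar * (1 - tvar) * pderiv (Dge2 (n - 1)))
        + to_fract (D1 (n - 1)) + inverse (to_fract tvar) * to_fract (D01 (n - 1))
        + to_fract (D0ge2 (n - 1)))
   \<and> (D0ge2 n = (2 * of_nat n - 3) * tvar * D0ge2 (n - 1)
        + 2 * tvar * (1 - tvar) * pderiv (D0ge2 (n - 1))
        + tvar * D1 (n - 1) + D01 (n - 1) + tvar * Dge2 (n - 1))"
proof -
  \<comment> \<open>All identities are proved for the doubled polynomials, and the factor 2 is then cancelled.\<close>
  define m where "m = n - 1"
  have n: "n = Suc m" and m: "m \<ge> 2" using assms by (auto simp: m_def)
  define t where "t = tvar"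
  have dt: "pderiv t = 1" by (simp add: t_def pderiv_pCons)
  have dt2: "pderiv (t ^ 2) = 2 * t" by (simp add: power2_eq_square pderiv_mult dt)
  have "t \<noteq> 0" by (simp add: t_def)
  define c :: "int poly" where "c = of_nat m"
  have cn: "of_nat n = c + 1" by (simp add: n c_def)
  define P P0 P1 P01 where P_defs: "P = tail_poly {} m" "P0 = tail_poly {0} m"
    "P1 = tail_poly {1} m" "P01 = tail_poly {0, 1} m"
  note at_m = sub_Eulerian_poly_eq[OF m, folded t_def]
  have D_m: "2 * Dge2 m = P" "2 * D0ge2 m = t * P0" "2 * D1 m = t * P1" "2 * D01 m = t ^ 2 * P01"
    unfolding at_m P_defs by (simp_all add: power2_eq_square)
  have d2: "2 * pderiv p = pderiv (2 * p)" for p :: "int poly"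
    unfolding mult_2 pderiv_add ..
  have dD_m: "2 * pderiv (Dge2 m) = pderiv P" "2 * pderiv (D0ge2 m) = P0 + t * pderiv P0"
    "2 * pderiv (D1 m) = P1 + t * pderiv P1"
    "2 * pderiv (D01 m) = 2 * t * P01 + t ^ 2 * pderiv P01"
    unfolding d2 D_m by (simp_all add: pderiv_mult dt dt2)
  have "n \<ge> 2" using assms by simp
  note at_n = sub_Eulerian_poly_eq[OF this, folded t_def]
  note rec = tail_poly_Suc[OF m, folded n t_def P_defs c_def]
  have types: "{0, 1} \<noteq> {1 :: nat}" "{0, 1} \<noteq> {0 :: nat}" "{0} \<noteq> {0, 1 :: nat}" "{1} \<noteq> {0, 1 :: nat}" by auto
  have D_n: "2 * Dge2 n = t * (P + P0 + P1 + P01) + (1 + (2 * c - 3) * t) * P + 2 * t * (1 - t) * pderiv P"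
    "2 * D0ge2 n = t * (P + P0 + t * (P1 + P01) + (1 + (2 * c - 3) * t) * P0 + 2 * t * (1 - t) * pderiv P0)"
    "2 * D1 n = t * (P + P0 + t * (P1 + P01) + (1 + (2 * c - 3) * t) * P1 + 2 * t * (1 - t) * pderiv P1)"
    "2 * D01 n = t ^ 2 * (P + P0 + P1 + P01 + (1 + (2 * c - 3) * t) * P01 + 2 * t * (1 - t) * pderiv P01)"
    unfolding at_n rec by (simp_all add: P_defs types power2_eq_square)
  have cancel: "p = q" if "2 * p = 2 * q" for p q :: "int poly" using that by simp
  have 1: "D1 n = (2 * (of_nat n - 1) * t - 1) * D1 m + 2 * t * (1 - t) * pderiv (D1 m)
      + D01 m + t * Dge2 m + D0ge2 m"
    by (rule cancel, unfold cn) (use D_n D_m dD_m in algebra)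
  have 2: "D01 n = ((2 * of_nat n - 1) * t - 2) * D01 m + 2 * t * (1 - t) * pderiv (D01 m)
      + t * D1 m + t ^ 2 * Dge2 m + t * D0ge2 m"
    by (rule cancel, unfold cn) (use D_n D_m dD_m in algebra)
  \<comment> \<open>The third equation, cleared of the denominator \<open>t\<close>.\<close>
  have 3: "t * Dge2 n = t * ((2 * (of_nat n - 2) * t + 1) * Dge2 m + 2 * t * (1 - t) * pderiv (Dge2 m)
      + D1 m + D0ge2 m) + D01 m"
    by (rule cancel, unfold cn) (use D_n D_m dD_m in algebra)
  have 4: "D0ge2 n = (2 * of_nat n - 3) * t * D0ge2 m + 2 * t * (1 - t) * pderiv (D0ge2 m)
      + t * D1 m + D01 m + t * Dge2 m"
    by (rule cancel, unfold cn) (use D_n D_m dD_m in algebra)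
  have divide: "x = p + q + r + inverse a * b + s" if "a \<noteq> 0" "a * x = a * (p + q + r + s) + b"
    for a b x p q r s :: "int poly fract"
  proof -
    have "a * x = a * (p + q + r + inverse a * b + s)"
      using that by (simp add: distrib_left mult.assoc[symmetric])
    then show ?thesis using that(1) by simp
  qed
  have "to_fract t \<noteq> 0" using \<open>t \<noteq> 0\<close> by simp
  moreover have "to_fract t * to_fract (Dge2 n) = to_fract t * (to_fract ((2 * (of_nat n - 2) * t + 1) * Dge2 m)
      + to_fract (2 * t * (1 - t) * pderiv (Dge2 m)) + to_fract (D1 m) + to_fract (D0ge2 m))
      + to_fract (D01 m)"
    using arg_cong[OF 3, of to_fract] by (simp only: to_fract_add to_fract_mult)
  ultimately have "to_fract (Dge2 n) = to_fract ((2 * (of_nat n - 2) * t + 1) * Dge2 m)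
      + to_fract (2 * t * (1 - t) * pderiv (Dge2 m)) + to_fract (D1 m)
      + inverse (to_fract t) * to_fract (D01 m) + to_fract (D0ge2 m)"
    by (rule divide)
  with 1 2 4 show ?thesis unfolding m_def[symmetric] t_def by blast
qed

end
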